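(* Let $H=\Bbbk^{\mathbb{Z}_2}{}^\tau\#_{\sigma}\Bbbk F$. If the Grothendieck ring $\operatorname{Gr}(H\text{-comod})$ of the category of finite-dimensional right $H$-comodules is commutative, then $S=\{f\in F\mid g\triangleright f=f\}$ is an abelian group.
   Context: $\Bbbk$ is an algebraically closed field of characteristic zero, $G=\mathbb{Z}_2=\langle g\mid g^2=1\rangle$ and $F$ is an arbitrary group. $(F,G,\triangleleft,\triangleright)$ is a matched pair of groups: $\triangleleft:G\times F\to G$ is a right action of $F$ on the set $G$ and $\triangleright:G\times F\to F$ is a left action of $G$ on the set $F$, such that $a\triangleright(ff')=(a\triangleright f)((a\triangleleft f)\triangleright f')$ and $(ab)\triangleleft f=(a\triangleleft(b\triangleright f))(b\triangleleft f)$ for all $a,b\in G$, $f,f'\in F$. (For $G=\mathbb{Z}_2$ the action $\triangleleft$ is necessarily trivial.) The maps $\sigma:G\times F\times F\to\Bbbk^\times$ and $\tau:G\times G\times F\to\Bbbk^\times$ satisfy, for all $a,b,c\in G$, $f,f',f''\in F$: $\sigma(a;1_F,f)=\sigma(a;f,1_F)=\sigma(1_G;f,f')=1$; $\sigma(a\triangleleft f;f',f'')\sigma(a;f,f'f'')=\sigma(a;f,f')\sigma(a;ff',f'')$; $\tau(1_G,a;f)=\tau(a,1_G;f)=\tau(a,b;1_F)=1$; $\tau(a,b;c\triangleright f)\tau(ab,c;f)=\tau(a,bc;f)\tau(b,c;f)$; $\sigma(ab;f,f')\tau(a,b;ff')=\sigma(a;b\triangleright f,(b\triangleleft f)\triangleright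 f')\,\sigma(b;f,f')\,\tau(a,b;f)\,\tau(a\triangleleft(b\triangleright f),b\triangleleft f;f')$. The Hopf algebra $\Bbbk^G{}^\tau\#_{\sigma}\Bbbk F$ is the vector space $\Bbbk^G\otimes\Bbbk F$ with basis $p_a\# f:=p_a\otimes f$ ($a\in G,f\in F$; $\{p_a\}$ is the basis of $\Bbbk^G$ dual to $G\subset\Bbbk G$), multiplication $(p_a\# f)(p_{b}\# f')=\delta_{a\triangleleft f,b}\sigma(a;f,f')\,p_a\# ff'$, comultiplication $\Delta(p_a\# f)=\sum_{x\in G}\tau(ax^{-1},x;f)\,(p_{ax^{-1}}\#(x\triangleright f))\otimes(p_x\# f)$, unit $\sum_{a\in G}p_a\#1_F$ and counit $\varepsilon(p_a\# f)=\delta_{a,1_G}$. It is cosemisimple. The Grothendieck ring has the isomorphism classes of simple right $H$-comodules as $\mathbb{Z}$-basis and multiplication induced by $\otimes$. *)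

theory Defs
  imports "HOL-Library.Poly_Mapping" "HOL-Algebra.Free_Abelian_Groups" "HOL-Algebra.Ring"
    "HOL-Computational_Algebra.Polynomial"
begin

section \<open>Vector spaces with a chosen basis\<close>

text \<open>
  The type \<^typ>\<open>'a \<Rightarrow>\<^sub>0 'k\<close> is the \<open>'k\<close>-vector space with basis \<open>'a\<close>; the tensor product of
  the spaces with bases \<open>'a\<close> and \<open>'b\<close> is the space with basis \<^typ>\<open>'a \<times> 'b\<close>, the pair
  \<open>(a, b)\<close> standing for the elementary tensor of \<open>a\<close> and \<open>b\<close>. Linear maps out of such a space are
  given on the basis and extended by \<open>lin_ext\<close>.
\<close>

definition vscale :: "'k::field \<Rightarrow> ('a \<Rightarrow>\<^sub>0 'k) \<Rightarrow> ('a \<Rightarrow>\<^sub>0 'k)"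
  where "vscale c x = Poly_Mapping.map ((*) c) x"

lemma lookup_vscale [simp]:
  "Poly_Mapping.lookup (vscale c x) a = c * Poly_Mapping.lookup x a"
  by (simp add: vscale_def Poly_Mapping.map.rep_eq when_def)

interpretation vec: vector_space "vscale :: 'k::field \<Rightarrow> ('a \<Rightarrow>\<^sub>0 'k) \<Rightarrow> ('a \<Rightarrow>\<^sub>0 'k)"
  by standard (auto intro!: poly_mapping_eqI simp: lookup_add algebra_simps)

abbreviation bvec :: "'a \<Rightarrow> ('a \<Rightarrow>\<^sub>0 'k::field)"
  where "bvec a \<equiv> Poly_Mapping.single a 1"

definition lin_ext :: "('a \<Rightarrow> ('b \<Rightarrow>\<^sub>0 'k)) \<Rightarrow> ('a \<Rightarrow>\<^sub>0 'k) \<Rightarrow> ('b \<Rightarrow>\<^sub>0 'k::field)"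
  where
    "lin_ext f x = (\<Sum>a\<in>Poly_Mapping.keys x. vscale (Poly_Mapping.lookup x a) (f a))"

definition coord_space :: "'a set \<Rightarrow> ('a \<Rightarrow>\<^sub>0 'k::field) set"
  where "coord_space I = {x. Poly_Mapping.keys x \<subseteq> I}"


section \<open>Bialgebras with a chosen basis\<close>

text \<open>
  Structure constants of a bialgebra with basis \<open>hbasis\<close>: products, coproducts and counits of basis
  elements, and the unit element. Values outside \<open>hbasis\<close> are irrelevant.
\<close>

record (overloaded) ('b, 'k) based_bialgebra =
  hbasis :: "'b set"
  hmult :: "'b \<Rightarrow> 'b \<Rightarrow> ('b \<Rightarrow>\<^sub>0 'k)"
  hunit :: "'b \<Rightarrow>\<^sub>0 'k"
  hcomult :: "'b \<Rightarrow> ('b \<times> 'b \<Rightarrow>\<^sub>0 'k)"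
  hcounit :: "'b \<Rightarrow> 'k"


section \<open>Finite-dimensional right comodules\<close>

text \<open>
  A finite-dimensional right comodule is carried by the coordinate space of a finite index set
  \<open>cidx\<close>; its coaction \<open>V \<rightarrow> V \<otimes> H\<close> is given on the basis by \<open>coact\<close>. Every finite-dimensional
  comodule is isomorphic to one of this form, with index type \<^typ>\<open>nat\<close>.
\<close>

record (overloaded) ('i, 'b, 'k) comodule =
  cidx :: "'i set"
  coact :: "'i \<Rightarrow> ('i \<times> 'b \<Rightarrow>\<^sub>0 'k)"

definition right_comodule ::
  "('b, 'k::field) based_bialgebra \<Rightarrow> ('i, 'b, 'k) comodule \<Rightarrow> bool"
  where "right_comodule H M \<longleftrightarrow>
    finite (cidx M) \<and>
    (\<forall>i\<in>cidx M. coact M i \<in> coord_space (cidx M \<times> hbasis H)) \<and>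
    \<comment> \<open>\<open>(\<rho> \<otimes> id) \<rho> = (id \<otimes> \<Delta>) \<rho>\<close>\<close>
    (\<forall>i\<in>cidx M.
       lin_ext (\<lambda>(j, d). lin_ext (\<lambda>(k, c). bvec (k, c, d)) (coact M j)) (coact M i) =
       lin_ext (\<lambda>(k, b). lin_ext (\<lambda>(c, d). bvec (k, c, d)) (hcomult H b)) (coact M i)) \<and>
    \<comment> \<open>\<open>(id \<otimes> \<epsilon>) \<rho> = id\<close>\<close>
    (\<forall>i\<in>cidx M. lin_ext (\<lambda>(j, b). vscale (hcounit H b) (bvec j)) (coact M i) = bvec i)"

definition comodule_iso ::
  "('i, 'b, 'k::field) comodule \<Rightarrow> ('j, 'b, 'k) comodule \<Rightarrow> bool"
  where "comodule_iso M N \<longleftrightarrow>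
    (\<exists>\<phi> :: ('i \<Rightarrow>\<^sub>0 'k) \<Rightarrow> ('j \<Rightarrow>\<^sub>0 'k).
       Vector_Spaces.linear vscale vscale \<phi> \<and>
       bij_betw \<phi> (coord_space (cidx M)) (coord_space (cidx N)) \<and>
       \<comment> \<open>\<open>\<rho> \<phi> = (\<phi> \<otimes> id) \<rho>\<close>\<close>
       (\<forall>v\<in>coord_space (cidx M).
          lin_ext (coact N) (\<phi> v) =
          lin_ext (\<lambda>(i, b). lin_ext (\<lambda>j. bvec (j, b)) (\<phi> (bvec i))) (lin_ext (coact M) v)))"

definition subcomodule ::
  "('b, 'k::field) based_bialgebra \<Rightarrow> ('i, 'b, 'k) comodule \<Rightarrow> ('i \<Rightarrow>\<^sub>0 'k) set \<Rightarrow> bool"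
  where "subcomodule H M W \<longleftrightarrow>
    vec.subspace W \<and> W \<subseteq> coord_space (cidx M) \<and>
    \<comment> \<open>\<open>\<rho> W \<subseteq> W \<otimes> H\<close>\<close>
    (\<forall>w\<in>W. lin_ext (coact M) w \<in>
       vec.span {lin_ext (\<lambda>i. bvec (i, b)) u | u b. u \<in> W \<and> b \<in> hbasis H})"

definition simple_comodule ::
  "('b, 'k::field) based_bialgebra \<Rightarrow> ('i, 'b, 'k) comodule \<Rightarrow> bool"
  where "simple_comodule H M \<longleftrightarrow>
    right_comodule H M \<and> cidx M \<noteq> {} \<and>
    (\<forall>W. subcomodule H M W \<longrightarrow> W = {0} \<or> W = coord_space (cidx M))"

text \<open>Coaction of the tensor product: \<open>v \<otimes> w \<mapsto> v\<^sub>0 \<otimes> w\<^sub>0 \<otimes> v\<^sub>1 w\<^sub>1\<close>.\<close>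

definition tensor_comodule ::
  "('b, 'k::field) based_bialgebra \<Rightarrow> ('i, 'b, 'k) comodule \<Rightarrow> ('j, 'b, 'k) comodule
     \<Rightarrow> ('i \<times> 'j, 'b, 'k) comodule"
  where "tensor_comodule H M N =
    \<lparr> cidx = cidx M \<times> cidx N,
      coact = (\<lambda>(i, j).
        lin_ext (\<lambda>(k, b).
          lin_ext (\<lambda>(l, c). lin_ext (\<lambda>d. bvec ((k, l), d)) (hmult H b c)) (coact N j))
          (coact M i)) \<rparr>"

definition unit_comodule :: "('b, 'k::field) based_bialgebra \<Rightarrow> (unit, 'b, 'k) comodule"
  where "unit_comodule H =
    \<lparr> cidx = {()}, coact = (\<lambda>i. lin_ext (\<lambda>b. bvec (i, b)) (hunit H)) \<rparr>"

text \<open>The index \<open>(n, i)\<close> is the basis vector \<open>i\<close> of the \<open>n\<close>-th summand.\<close>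

definition direct_sum_comodule ::
  "('i, 'b, 'k::field) comodule list \<Rightarrow> (nat \<times> 'i, 'b, 'k) comodule"
  where "direct_sum_comodule Us =
    \<lparr> cidx = (SIGMA n:{..<length Us}. cidx (Us ! n)),
      coact = (\<lambda>(n, i). lin_ext (\<lambda>(j, b). bvec ((n, j), b)) (coact (Us ! n) i)) \<rparr>"


section \<open>The Grothendieck ring of a cosemisimple bialgebra\<close>

type_synonym ('b, 'k) comodule_class = "(nat, 'b, 'k) comodule set"

definition iso_class ::
  "('b, 'k::field) based_bialgebra \<Rightarrow> ('i, 'b, 'k) comodule \<Rightarrow> ('b, 'k) comodule_class"
  where "iso_class H M = {N. right_comodule H N \<and> comodule_iso M N}"

definition simple_classes ::
  "('b, 'k::field) based_bialgebra \<Rightarrow> ('b, 'k) comodule_class set"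
  where "simple_classes H = iso_class H ` {U :: (nat, 'b, 'k) comodule. simple_comodule H U}"

text \<open>
  The element of the Grothendieck ring defined by a comodule \<open>M\<close>: if \<open>M\<close> is isomorphic to the direct
  sum of the simple comodules \<open>U\<^sub>1, \<dots>, U\<^sub>n\<close>, it is the sum of their classes. Over a cosemisimple \<open>H\<close>
  such a decomposition exists, and by Krull-Schmidt the sum does not depend on it.
\<close>

definition groth_class ::
  "('b, 'k::field) based_bialgebra \<Rightarrow> ('i, 'b, 'k) comodule
     \<Rightarrow> (('b, 'k) comodule_class \<Rightarrow>\<^sub>0 int)"
  where "groth_class H M =
    (THE x. \<exists>Us :: (nat, 'b, 'k) comodule list.
       (\<forall>U\<in>set Us. simple_comodule H U) \<and>
       comodule_iso M (direct_sum_comodule Us) \<and>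
       x = (\<Sum>U\<leftarrow>Us. frag_of (iso_class H U)))"

text \<open>The product of two basis elements is the element defined by the tensor product of representatives.\<close>

definition groth_basis_mult ::
  "('b, 'k::field) based_bialgebra \<Rightarrow> ('b, 'k) comodule_class \<Rightarrow> ('b, 'k) comodule_class
     \<Rightarrow> (('b, 'k) comodule_class \<Rightarrow>\<^sub>0 int)"
  where "groth_basis_mult H C D =
    groth_class H (tensor_comodule H (SOME M. M \<in> C) (SOME N. N \<in> D))"

definition Gr :: "('b, 'k::field) based_bialgebra \<Rightarrow> (('b, 'k) comodule_class \<Rightarrow>\<^sub>0 int) ring"
  where "Gr H =
    \<lparr> carrier = carrier (free_Abelian_group (simple_classes H)),
      monoid.mult = (\<lambda>x y. frag_extend (\<lambda>C. frag_extend (groth_basis_mult H C) y) x),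
      one = groth_class H (unit_comodule H),
      zero = 0,
      add = (+) \<rparr>"


section \<open>Matched pairs of groups and the bicrossed product\<close>

text \<open>
  \<open>ract a f\<close> is the right action of \<open>F\<close> on the set \<open>G\<close>, \<open>lact a f\<close> the left action of \<open>G\<close> on the
  set \<open>F\<close>.
\<close>

locale matched_pair = F: group F + G: group G
  for F :: "('f, 'm) monoid_scheme" and G :: "('g, 'n) monoid_scheme" +
  fixes ract :: "'g \<Rightarrow> 'f \<Rightarrow> 'g" and lact :: "'g \<Rightarrow> 'f \<Rightarrow> 'f"
  assumes ract_closed: "\<lbrakk>a \<in> carrier G; f \<in> carrier F\<rbrakk> \<Longrightarrow> ract a f \<in> carrier G"
    and ract_one: "a \<in> carrier G \<Longrightarrow> ract a \<one>\<^bsub>F\<^esub> = a"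
    and ract_mult: "\<lbrakk>a \<in> carrier G; f \<in> carrier F; f' \<in> carrier F\<rbrakk>
      \<Longrightarrow> ract a (f \<otimes>\<^bsub>F\<^esub> f') = ract (ract a f) f'"
    and lact_closed: "\<lbrakk>a \<in> carrier G; f \<in> carrier F\<rbrakk> \<Longrightarrow> lact a f \<in> carrier F"
    and lact_one: "f \<in> carrier F \<Longrightarrow> lact \<one>\<^bsub>G\<^esub> f = f"
    and lact_mult: "\<lbrakk>a \<in> carrier G; b \<in> carrier G; f \<in> carrier F\<rbrakk>
      \<Longrightarrow> lact (a \<otimes>\<^bsub>G\<^esub> b) f = lact a (lact b f)"
    and lact_compat: "\<lbrakk>a \<in> carrier G; f \<in> carrier F; f' \<in> carrier F\<rbrakk>
      \<Longrightarrow> lact a (f \<otimes>\<^bsub>F\<^esub> f') = lact a f \<otimes>\<^bsub>F\<^esub> lact (ract a f) f'"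
    and ract_compat: "\<lbrakk>a \<in> carrier G; b \<in> carrier G; f \<in> carrier F\<rbrakk>
      \<Longrightarrow> ract (a \<otimes>\<^bsub>G\<^esub> b) f = ract a (lact b f) \<otimes>\<^bsub>G\<^esub> ract b f"

locale cocycle_matched_pair = matched_pair F G ract lact
  for F :: "('f, 'm) monoid_scheme" and G :: "('g, 'n) monoid_scheme"
    and ract :: "'g \<Rightarrow> 'f \<Rightarrow> 'g" and lact :: "'g \<Rightarrow> 'f \<Rightarrow> 'f" +
  fixes \<sigma> :: "'g \<Rightarrow> 'f \<Rightarrow> 'f \<Rightarrow> 'k::field" and \<tau> :: "'g \<Rightarrow> 'g \<Rightarrow> 'f \<Rightarrow> 'k"
  assumes sigma_nonzero: "\<lbrakk>a \<in> carrier G; f \<in> carrier F; f' \<in> carrier F\<rbrakk> \<Longrightarrow> \<sigma> a f f' \<noteq> 0"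
    and tau_nonzero: "\<lbrakk>a \<in> carrier G; b \<in> carrier G; f \<in> carrier F\<rbrakk> \<Longrightarrow> \<tau> a b f \<noteq> 0"
    and sigma_normal:
      "\<lbrakk>a \<in> carrier G; f \<in> carrier F\<rbrakk> \<Longrightarrow> \<sigma> a \<one>\<^bsub>F\<^esub> f = 1"
      "\<lbrakk>a \<in> carrier G; f \<in> carrier F\<rbrakk> \<Longrightarrow> \<sigma> a f \<one>\<^bsub>F\<^esub> = 1"
      "\<lbrakk>f \<in> carrier F; f' \<in> carrier F\<rbrakk> \<Longrightarrow> \<sigma> \<one>\<^bsub>G\<^esub> f f' = 1"
    and sigma_cocycle:
      "\<lbrakk>a \<in> carrier G; f \<in> carrier F; f' \<in> carrier F; f'' \<in> carrier F\<rbrakk>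
        \<Longrightarrow> \<sigma> (ract a f) f' f'' * \<sigma> a f (f' \<otimes>\<^bsub>F\<^esub> f'') = \<sigma> a f f' * \<sigma> a (f \<otimes>\<^bsub>F\<^esub> f') f''"
    and tau_normal:
      "\<lbrakk>a \<in> carrier G; f \<in> carrier F\<rbrakk> \<Longrightarrow> \<tau> \<one>\<^bsub>G\<^esub> a f = 1"
      "\<lbrakk>a \<in> carrier G; f \<in> carrier F\<rbrakk> \<Longrightarrow> \<tau> a \<one>\<^bsub>G\<^esub> f = 1"
      "\<lbrakk>a \<in> carrier G; b \<in> carrier G\<rbrakk> \<Longrightarrow> \<tau> a b \<one>\<^bsub>F\<^esub> = 1"
    and tau_cocycle:
      "\<lbrakk>a \<in> carrier G; b \<in> carrier G; c \<in> carrier G; f \<in> carrier F\<rbrakk>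
        \<Longrightarrow> \<tau> a b (lact c f) * \<tau> (a \<otimes>\<^bsub>G\<^esub> b) c f = \<tau> a (b \<otimes>\<^bsub>G\<^esub> c) f * \<tau> b c f"
    and sigma_tau_compat:
      "\<lbrakk>a \<in> carrier G; b \<in> carrier G; f \<in> carrier F; f' \<in> carrier F\<rbrakk>
        \<Longrightarrow> \<sigma> (a \<otimes>\<^bsub>G\<^esub> b) f f' * \<tau> a b (f \<otimes>\<^bsub>F\<^esub> f') =
            \<sigma> a (lact b f) (lact (ract b f) f') * \<sigma> b f f' *
            \<tau> a b f * \<tau> (ract a (lact b f)) (ract b f) f'"

text \<open>The basis element \<open>(a, f)\<close> is \<open>p\<^sub>a # f\<close>. The group \<open>G\<close> is meant to be finite, so that the sums make sense.\<close>

definition bicrossed_product ::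
  "('f, 'm) monoid_scheme \<Rightarrow> ('g, 'n) monoid_scheme \<Rightarrow> ('g \<Rightarrow> 'f \<Rightarrow> 'g) \<Rightarrow> ('g \<Rightarrow> 'f \<Rightarrow> 'f)
     \<Rightarrow> ('g \<Rightarrow> 'f \<Rightarrow> 'f \<Rightarrow> 'k::field) \<Rightarrow> ('g \<Rightarrow> 'g \<Rightarrow> 'f \<Rightarrow> 'k) \<Rightarrow> ('g \<times> 'f, 'k) based_bialgebra"
  where "bicrossed_product F G ract lact \<sigma> \<tau> =
    \<lparr> hbasis = carrier G \<times> carrier F,
      hmult = (\<lambda>(a, f) (b, f').
        if ract a f = b then Poly_Mapping.single (a, f \<otimes>\<^bsub>F\<^esub> f') (\<sigma> a f f') else 0),
      hunit = (\<Sum>a\<in>carrier G. bvec (a, \<one>\<^bsub>F\<^esub>)),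
      hcomult = (\<lambda>(a, f). \<Sum>x\<in>carrier G.
        Poly_Mapping.single ((a \<otimes>\<^bsub>G\<^esub> inv\<^bsub>G\<^esub> x, lact x f), (x, f)) (\<tau> (a \<otimes>\<^bsub>G\<^esub> inv\<^bsub>G\<^esub> x) x f)),
      hcounit = (\<lambda>(a, f). if a = \<one>\<^bsub>G\<^esub> then 1 else 0) \<rparr>"

end

theory Submission
  imports Defs
begin

text \<open>
  A grouplike element \<open>h\<close> of a bialgebra spans a one-dimensional comodule \<open>v \<mapsto> v \<otimes> h\<close>. Such a
  comodule is simple, its isomorphism class determines \<open>h\<close>, and the tensor product of the comodules
  of \<open>h\<close> and \<open>h'\<close> is the comodule of \<open>h h'\<close>. Hence, wherever products of grouplike elements are
  again grouplike, a commutative Grothendieck ring forces the grouplike elements to commute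
  (\<open>grouplikes_commute_if_Gr_commutative\<close>). Only one-dimensional comodules enter, and for these
  the decomposition into simple comodules is unique by a dimension count.

  It remains to see that \<open>S\<close> is covered by grouplike elements. When \<open>G = {1, g}\<close>, the action of
  \<open>F\<close> on \<open>G\<close> is trivial, so \<open>g\<close> acts on \<open>F\<close> by a group automorphism and its fixed points \<open>S\<close>
  form a subgroup. For \<open>s\<close> in \<open>S\<close> the element \<open>p\<^sub>1 # s + c p\<^sub>g # s\<close> is grouplike as soon as
  \<open>c\<^sup>2 = \<tau>(g, g; s)\<close> (\<open>grouplike_gl_elem\<close>), which has a solution over an algebraically closed
  field. The product of the elements given by \<open>(s, c)\<close> and \<open>(t, d)\<close> is the one given by
  \<open>(s t, c d \<sigma>(g; s, t))\<close>, and the compatibility of \<open>\<sigma>\<close> with \<open>\<tau>\<close> is exactly what makes the new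
  scalar a square root of \<open>\<tau>(g, g; s t)\<close> (\<open>tau_mult\<close>). These elements commute, and comparing
  supports gives \<open>s t = t s\<close>.
\<close>

section \<open>Linear extension\<close>

lemma lin_ext_superset:
  assumes "finite A" "Poly_Mapping.keys x \<subseteq> A"
  shows "lin_ext f x = (\<Sum>a\<in>A. vscale (Poly_Mapping.lookup x a) (f a))"
  unfolding lin_ext_def
  by (rule sum.mono_neutral_left) (use assms in \<open>auto simp: in_keys_iff\<close>)

lemma vscale_single: "vscale c (Poly_Mapping.single a d) = Poly_Mapping.single a (c * d)"
  by (rule poly_mapping_eqI) (simp add: lookup_single when_def)

lemma lin_ext_add: "lin_ext f (x + y) = lin_ext f x + lin_ext f y"
proof -
  let ?A = "Poly_Mapping.keys x \<union> Poly_Mapping.keys y"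
  have "lin_ext f (x + y) = (\<Sum>a\<in>?A. vscale (Poly_Mapping.lookup (x + y) a) (f a))"
    by (rule lin_ext_superset) (use Poly_Mapping.keys_add[of x y] in auto)
  also have "\<dots> = (\<Sum>a\<in>?A. vscale (Poly_Mapping.lookup x a) (f a))
                + (\<Sum>a\<in>?A. vscale (Poly_Mapping.lookup y a) (f a))"
    by (simp add: lookup_add vec.scale_left_distrib sum.distrib)
  also have "\<dots> = lin_ext f x + lin_ext f y"
    by (simp add: lin_ext_superset[where A = ?A])
  finally show ?thesis .
qed

lemma lin_ext_zero [simp]: "lin_ext f 0 = 0"
  by (simp add: lin_ext_def)

lemma lin_ext_vscale: "lin_ext f (vscale c x) = vscale c (lin_ext f x)"
proof -
  have "lin_ext f (vscale c x) =
      (\<Sum>a\<in>Poly_Mapping.keys x. vscale (Poly_Mapping.lookup (vscale c x) a) (f a))"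
    by (rule lin_ext_superset) (auto simp: in_keys_iff)
  then show ?thesis
    by (simp add: lin_ext_def vec.scale_sum_right)
qed

lemma lin_ext_single [simp]: "lin_ext f (Poly_Mapping.single a c) = vscale c (f a)"
  by (simp add: lin_ext_def)

lemma lin_ext_sum: "lin_ext f (\<Sum>a\<in>A. x a) = (\<Sum>a\<in>A. lin_ext f (x a))"
  by (induction A rule: infinite_finite_induct) (auto simp: lin_ext_add)

lemma lin_ext_comp: "lin_ext f (lin_ext u x) = lin_ext (\<lambda>a. lin_ext f (u a)) x"
  by (simp add: lin_ext_def[of u] lin_ext_def[of "\<lambda>a. lin_ext f (u a)"] lin_ext_sum lin_ext_vscale)

lemma linear_lin_ext: "Vector_Spaces.linear vscale vscale (lin_ext f)"
  by unfold_locales (simp_all add: lin_ext_add lin_ext_vscale)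

lemma lookup_lin_ext_inj:
  assumes "inj f"
  shows "Poly_Mapping.lookup (lin_ext (\<lambda>a. bvec (f a)) x) (f a) = Poly_Mapping.lookup x a"
  using assms
  by (simp add: lin_ext_def lookup_sum lookup_single when_def inj_eq if_distrib in_keys_iff sum.delta
      cong: if_cong)

definition elem_tensor :: "'i \<Rightarrow> ('b \<Rightarrow>\<^sub>0 'k::field) \<Rightarrow> ('i \<times> 'b \<Rightarrow>\<^sub>0 'k)"
  where "elem_tensor i h = lin_ext (\<lambda>b. bvec (i, b)) h"

lemma lookup_elem_tensor [simp]:
  "Poly_Mapping.lookup (elem_tensor i h) (j, b) = (if j = i then Poly_Mapping.lookup h b else 0)"
  by (auto simp: elem_tensor_def lin_ext_def lookup_sum lookup_single when_def in_keys_iff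
      if_distrib sum.delta cong: if_cong)

lemma elem_tensor_inject [simp]: "elem_tensor i h = elem_tensor i h' \<longleftrightarrow> h = h'"
  by (metis lookup_elem_tensor poly_mapping_eqI)

lemma lin_ext_elem_tensor: "lin_ext f (elem_tensor i h) = lin_ext (\<lambda>b. f (i, b)) h"
  by (simp add: elem_tensor_def lin_ext_comp)

section \<open>One-dimensional comodules\<close>

definition one_dim :: "('b \<Rightarrow>\<^sub>0 'k::field) \<Rightarrow> ('i, 'b, 'k) comodule \<Rightarrow> bool"
  where "one_dim h M \<longleftrightarrow> (\<exists>i. cidx M = {i} \<and> coact M i = elem_tensor i h)"

lemma one_dim_unique: "one_dim h M \<Longrightarrow> one_dim h' M \<Longrightarrow> h = h'"
  by (auto simp: one_dim_def)

lemma coord_space_singleton: "coord_space {i} = range (\<lambda>c. vscale c (bvec i))"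
proof (intro equalityI subsetI)
  fix x :: "'a \<Rightarrow>\<^sub>0 'b" assume "x \<in> coord_space {i}"
  then have "x = vscale (Poly_Mapping.lookup x i) (bvec i)"
    by (intro poly_mapping_eqI) (auto simp: coord_space_def lookup_single when_def in_keys_iff)
  then show "x \<in> range (\<lambda>c. vscale c (bvec i))" by blast
qed (auto simp: coord_space_def in_keys_iff lookup_single when_def split: if_splits)

text \<open>
  The underlying linear isomorphism sends the basis vector of \<open>M\<close> to a nonzero multiple of a single
  basis vector of \<open>N\<close>; the multiple cancels from the compatibility with the coactions.
\<close>

lemma comodule_iso_one_dimD:
  assumes M: "one_dim h M" and iso: "comodule_iso M N"
  shows "one_dim h N"
proof -
  obtain i where i: "cidx M = {i}" "coact M i = elem_tensor i h"
    using M by (auto simp: one_dim_def)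
  obtain \<phi> where lin: "Vector_Spaces.linear vscale vscale \<phi>"
    and bij: "bij_betw \<phi> (coord_space {i}) (coord_space (cidx N))"
    and comm: "\<And>v. v \<in> coord_space {i} \<Longrightarrow> lin_ext (coact N) (\<phi> v) =
          lin_ext (\<lambda>(i, b). lin_ext (\<lambda>j. bvec (j, b)) (\<phi> (bvec i))) (lin_ext (coact M) v)"
    using iso i unfolding comodule_iso_def by auto
  interpret Vector_Spaces.linear vscale vscale \<phi> by (fact lin)
  define v where "v = \<phi> (bvec i)"
  have bi: "bvec i \<in> coord_space {i}" by (simp add: coord_space_def)
  have img: "coord_space (cidx N) = range (\<lambda>c. vscale c v)"
    using bij by (auto simp: bij_betw_def coord_space_singleton scale v_def image_image)
  have "v \<noteq> 0"
  proof
    assume "v = 0"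
    then have "\<phi> (bvec i) = \<phi> 0" by (simp add: v_def zero)
    then have "bvec i = (0 :: _ \<Rightarrow>\<^sub>0 'b)"
      using inj_onD[OF bij_betw_imp_inj_on[OF bij] _ bi, of 0] by (simp add: coord_space_def)
    then show False by (metis lookup_single_eq lookup_zero zero_neq_one)
  qed
  then obtain k where k: "k \<in> Poly_Mapping.keys v"
    by (meson keys_eq_empty ex_in_conv)
  have "v \<in> coord_space (cidx N)"
    unfolding img by (metis rangeI vec.scale_one)
  with k have kN: "k \<in> cidx N" by (auto simp: coord_space_def)
  \<comment> \<open>every basis vector of the target lies on the line through \<open>v\<close>, so there is only one\<close>
  have line: "Poly_Mapping.keys v = {j}" if "j \<in> cidx N" for j
  proof -
    have "bvec j \<in> range (\<lambda>c. vscale c v)"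
      using that by (simp add: img[symmetric] coord_space_def)
    then obtain c where c: "bvec j = vscale c v" by blast
    then have "c * Poly_Mapping.lookup v l = (if l = j then 1 else 0)" for l
      by (metis lookup_single_eq lookup_single_not_eq lookup_vscale)
    then have "Poly_Mapping.lookup v l \<noteq> 0 \<longleftrightarrow> l = j" for l
      by (metis mult_eq_0_iff zero_neq_one)
    then show ?thesis by (auto simp: in_keys_iff)
  qed
  have N: "cidx N = {k}"
    using line kN by auto
  then obtain c where c: "v = vscale c (bvec k)"
    using \<open>v \<in> coord_space (cidx N)\<close> unfolding N coord_space_singleton by blast
  then have "c \<noteq> 0" using \<open>v \<noteq> 0\<close> by auto
  have "vscale c (coact N k) = lin_ext (coact N) v"
    by (simp add: c lin_ext_vscale)
  also have "\<dots> = vscale c (elem_tensor k h)"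
    using comm[OF bi]
    by (simp add: i lin_ext_elem_tensor v_def[symmetric] c lin_ext_vscale)
       (simp add: elem_tensor_def lin_ext_def vec.scale_sum_right mult.commute)
  finally have "coact N k = elem_tensor k h"
    using \<open>c \<noteq> 0\<close> by simp
  with N show ?thesis by (auto simp: one_dim_def)
qed

lemma comodule_iso_one_dimI:
  assumes M: "one_dim h M" and N: "one_dim h N"
  shows "comodule_iso M N"
proof -
  obtain i where i: "cidx M = {i}" "coact M i = elem_tensor i h"
    using M by (auto simp: one_dim_def)
  obtain k where k: "cidx N = {k}" "coact N k = elem_tensor k h"
    using N by (auto simp: one_dim_def)
  let ?\<phi> = "lin_ext (\<lambda>_. bvec k)"
  have "bij_betw ?\<phi> (coord_space {i}) (coord_space {k})"
    unfolding coord_space_singleton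
    by (rule bij_betw_byWitness[where f' = "lin_ext (\<lambda>_. bvec i)"])
       (auto simp: lin_ext_vscale)
  moreover have "lin_ext (coact N) (?\<phi> v) =
      lin_ext (\<lambda>(i, b). lin_ext (\<lambda>j. bvec (j, b)) (?\<phi> (bvec i))) (lin_ext (coact M) v)"
    if "v \<in> coord_space {i}" for v
    using that unfolding coord_space_singleton
    by (auto simp: lin_ext_vscale i k lin_ext_elem_tensor) (simp add: elem_tensor_def)
  ultimately show ?thesis
    unfolding comodule_iso_def i k using linear_lin_ext by blast
qed

lemma iso_class_one_dim:
  assumes "one_dim h M"
  shows "iso_class H M = {N. right_comodule H N \<and> one_dim h N}"
  using comodule_iso_one_dimI comodule_iso_one_dimD assms by (auto simp: iso_class_def)

section \<open>Grouplike elements\<close>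

text \<open>
  The right-hand side of the second condition is \<open>h \<otimes> h\<close>, expanded in the second factor first because
  this is the order in which an iterated coaction produces it.
\<close>

definition grouplike :: "('b, 'k::field) based_bialgebra \<Rightarrow> ('b \<Rightarrow>\<^sub>0 'k) \<Rightarrow> bool"
  where "grouplike H h \<longleftrightarrow>
    h \<in> coord_space (hbasis H) \<and>
    lin_ext (hcomult H) h = lin_ext (\<lambda>d. lin_ext (\<lambda>c. bvec (c, d)) h) h \<and>
    (\<Sum>b\<in>Poly_Mapping.keys h. Poly_Mapping.lookup h b * hcounit H b) = 1"

definition algebra_mult ::
  "('b, 'k::field) based_bialgebra \<Rightarrow> ('b \<Rightarrow>\<^sub>0 'k) \<Rightarrow> ('b \<Rightarrow>\<^sub>0 'k) \<Rightarrow> ('b \<Rightarrow>\<^sub>0 'k)"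
  where "algebra_mult H h h' = lin_ext (\<lambda>b. lin_ext (hmult H b) h') h"

lemma right_comodule_grouplike:
  assumes h: "grouplike H h" and M: "one_dim h M"
  shows "right_comodule H M"
proof -
  obtain i where i: "cidx M = {i}" "coact M i = elem_tensor i h"
    using M by (auto simp: one_dim_def)
  have "elem_tensor i h \<in> coord_space ({i} \<times> hbasis H)"
    using h by (auto simp: grouplike_def coord_space_def in_keys_iff subset_iff split: if_splits)
  moreover have "lin_ext (\<lambda>(j, d). lin_ext (\<lambda>(k, c). bvec (k, c, d)) (coact M j)) (elem_tensor i h) =
       lin_ext (\<lambda>(k, b). lin_ext (\<lambda>(c, d). bvec (k, c, d)) (hcomult H b)) (elem_tensor i h)"
  proof -
    have "lin_ext (\<lambda>(k, b). lin_ext (\<lambda>(c, d). bvec (k, c, d)) (hcomult H b)) (elem_tensor i h) =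
      lin_ext (\<lambda>(c, d). bvec (i, c, d)) (lin_ext (hcomult H) h)"
      by (simp add: lin_ext_elem_tensor lin_ext_comp)
    also have "\<dots> = lin_ext (\<lambda>d. lin_ext (\<lambda>c. bvec (i, c, d)) h) h"
      using h by (simp add: grouplike_def lin_ext_comp)
    finally show ?thesis
      by (simp add: lin_ext_elem_tensor i)
  qed
  moreover have "lin_ext (\<lambda>(j, b). vscale (hcounit H b) (bvec j)) (elem_tensor i h) = bvec i"
  proof -
    have "lin_ext (\<lambda>(j, b). vscale (hcounit H b) (bvec j)) (elem_tensor i h) =
      vscale (\<Sum>b\<in>Poly_Mapping.keys h. Poly_Mapping.lookup h b * hcounit H b) (bvec i)"
      unfolding lin_ext_elem_tensor by (simp add: lin_ext_def vec.scale_sum_left)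
    then show ?thesis using h by (simp add: grouplike_def)
  qed
  ultimately show ?thesis
    unfolding right_comodule_def i by (simp add: i)
qed

lemma simple_comodule_grouplike:
  assumes h: "grouplike H h" and M: "one_dim h M"
  shows "simple_comodule H M"
proof -
  obtain i where i: "cidx M = {i}"
    using M by (auto simp: one_dim_def)
  have "W = coord_space {i}" if sub: "vec.subspace W" "W \<subseteq> coord_space {i}" and W: "W \<noteq> {0}" for W
  proof -
    obtain w where "w \<in> W" "w \<noteq> 0"
      using W vec.subspace_0[OF sub(1)] by blast
    then obtain c where c: "vscale c (bvec i) \<in> W" "c \<noteq> 0"
      using sub(2) unfolding coord_space_singleton by fastforce
    have "vscale d (bvec i) \<in> W" for d
      using vec.subspace_scale[OF sub(1) c(1), of "d / c"] c(2) by simp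
    then show ?thesis
      using sub(2) unfolding coord_space_singleton by blast
  qed
  then show ?thesis
    using right_comodule_grouplike[OF assms]
    by (auto simp: simple_comodule_def subcomodule_def i)
qed

lemma one_dim_tensor:
  assumes "one_dim h M" "one_dim h' N"
  shows "one_dim (algebra_mult H h h') (tensor_comodule H M N)"
proof -
  obtain i where i: "cidx M = {i}" "coact M i = elem_tensor i h"
    using assms by (auto simp: one_dim_def)
  obtain k where k: "cidx N = {k}" "coact N k = elem_tensor k h'"
    using assms by (auto simp: one_dim_def)
  show ?thesis unfolding one_dim_def
    by (rule exI[of _ "(i, k)"])
       (simp add: tensor_comodule_def i k lin_ext_elem_tensor algebra_mult_def lin_ext_comp elem_tensor_def)
qed

definition line_comodule :: "('b \<Rightarrow>\<^sub>0 'k::field) \<Rightarrow> (nat, 'b, 'k) comodule"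
  where "line_comodule h = \<lparr> cidx = {0}, coact = (\<lambda>i. elem_tensor i h) \<rparr>"

lemma one_dim_line_comodule: "one_dim h (line_comodule h)"
  by (simp add: one_dim_def line_comodule_def)

text \<open>
  The sum of one summand is that summand up to the relabelling \<open>i \<mapsto> (0, i)\<close> of the index set.
\<close>

lemma one_dim_direct_sum_singleton:
  "one_dim h (direct_sum_comodule [U]) \<longleftrightarrow> one_dim h U"
proof -
  have inj: "lin_ext (\<lambda>(j, b). bvec ((0::nat, j), b)) x = elem_tensor (0, i) h
      \<longleftrightarrow> x = elem_tensor i h" for i and x
  proof
    have lk: "Poly_Mapping.lookup (lin_ext (\<lambda>(j, b). bvec ((0::nat, j), b)) x) ((0, j), b)
        = Poly_Mapping.lookup x (j, b)" for j b
      using lookup_lin_ext_inj[of "\<lambda>(j, b). ((0::nat, j), b)" x "(j, b)"]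
      by (simp add: inj_on_def case_prod_unfold prod_eq_iff)
    assume *: "lin_ext (\<lambda>(j, b). bvec ((0::nat, j), b)) x = elem_tensor (0, i) h"
    show "x = elem_tensor i h"
    proof (rule poly_mapping_eqI)
      fix p
      show "Poly_Mapping.lookup x p = Poly_Mapping.lookup (elem_tensor i h) p"
        using lk[of "fst p" "snd p"] lookup_elem_tensor[of i h "fst p" "snd p"] by (simp add: *)
    qed
  next
    assume "x = elem_tensor i h"
    then show "lin_ext (\<lambda>(j, b). bvec ((0::nat, j), b)) x = elem_tensor (0, i) h"
      by (simp add: lin_ext_elem_tensor) (simp add: elem_tensor_def)
  qed
  have "cidx (direct_sum_comodule [U]) = Pair 0 ` cidx U"
    by (auto simp: direct_sum_comodule_def)
  then have "cidx (direct_sum_comodule [U]) = {p} \<longleftrightarrow> (\<exists>i. p = (0, i) \<and> cidx U = {i})" for p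
    by (cases p) (auto simp: image_iff set_eq_iff)
  then show ?thesis
    by (auto simp: one_dim_def direct_sum_comodule_def inj)
qed

text \<open>
  Each nonzero summand contributes at least one dimension, so a one-dimensional sum has one summand.
\<close>

lemma one_dim_direct_sumD:
  assumes "one_dim h (direct_sum_comodule Us)" "\<And>U. U \<in> set Us \<Longrightarrow> cidx U \<noteq> {}"
  obtains U where "Us = [U]" "one_dim h U"
proof -
  obtain p where p: "(SIGMA n:{..<length Us}. cidx (Us ! n)) = {p}"
    using assms(1) by (auto simp: one_dim_def direct_sum_comodule_def)
  have index: "n = fst p" if n: "n < length Us" for n
  proof -
    obtain j where "j \<in> cidx (Us ! n)" using assms(2)[OF nth_mem[OF n]] by blast
    with n have "(n, j) \<in> (SIGMA n:{..<length Us}. cidx (Us ! n))" by blast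
    then show ?thesis unfolding p by auto
  qed
  have "length Us \<le> 1"
    using index[of 0] index[of 1] by linarith
  moreover have "Us \<noteq> []"
  proof
    assume "Us = []"
    then have "{} = {p}" unfolding p[symmetric] by simp
    then show False by blast
  qed
  ultimately have "length Us = 1"
    by (simp add: le_Suc_eq)
  then obtain U where U: "Us = [U]"
    by (auto simp: length_Suc_conv)
  show ?thesis
    by (rule that[OF U]) (use assms(1) in \<open>simp only: U one_dim_direct_sum_singleton\<close>)
qed

text \<open>
  The definite description in \<open>groth_class\<close> is well defined here because any decomposition of a
  one-dimensional comodule is a single summand with the same grouplike element.
\<close>

lemma groth_class_one_dim:
  assumes h: "grouplike H h" and M: "one_dim h M"
  shows "groth_class H M = frag_of (iso_class H (line_comodule h))"
  unfolding groth_class_def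
proof (rule the_equality)
  show "\<exists>Us :: (nat, 'a, 'b) comodule list. (\<forall>U\<in>set Us. simple_comodule H U) \<and>
      comodule_iso M (direct_sum_comodule Us) \<and>
      frag_of (iso_class H (line_comodule h)) = (\<Sum>U\<leftarrow>Us. frag_of (iso_class H U))"
    by (rule exI[of _ "[line_comodule h]"])
       (simp add: simple_comodule_grouplike[OF h one_dim_line_comodule] one_dim_direct_sum_singleton
          one_dim_line_comodule comodule_iso_one_dimI[OF M])
next
  fix x
  assume "\<exists>Us :: (nat, 'a, 'b) comodule list. (\<forall>U\<in>set Us. simple_comodule H U) \<and>
      comodule_iso M (direct_sum_comodule Us) \<and> x = (\<Sum>U\<leftarrow>Us. frag_of (iso_class H U))"
  then obtain Us :: "(nat, 'a, 'b) comodule list"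
    where Us: "\<forall>U\<in>set Us. simple_comodule H U" "comodule_iso M (direct_sum_comodule Us)"
      and x: "x = (\<Sum>U\<leftarrow>Us. frag_of (iso_class H U))" by blast
  have "cidx U \<noteq> {}" if "U \<in> set Us" for U
    using Us(1) that by (simp add: simple_comodule_def)
  then obtain U where "Us = [U]" "one_dim h U"
    by (rule one_dim_direct_sumD[OF comodule_iso_one_dimD[OF M Us(2)]])
  then show "x = frag_of (iso_class H (line_comodule h))"
    by (simp add: x iso_class_one_dim[of h] one_dim_line_comodule)
qed

text \<open>
  The chosen representatives need not be the comodules \<open>line_comodule h\<close> themselves, but every member
  of the class is one-dimensional with the same grouplike element, so the choice does not matter.
\<close>

lemma groth_basis_mult_lines:
  assumes "grouplike H h" "grouplike H h'" "grouplike H (algebra_mult H h h')"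
  shows "groth_basis_mult H (iso_class H (line_comodule h)) (iso_class H (line_comodule h')) =
    frag_of (iso_class H (line_comodule (algebra_mult H h h')))"
proof -
  have chosen: "one_dim u (SOME M. M \<in> iso_class H (line_comodule u))" if "grouplike H u" for u
  proof -
    have "line_comodule u \<in> iso_class H (line_comodule u)"
      by (simp add: iso_class_one_dim[OF one_dim_line_comodule] one_dim_line_comodule
          right_comodule_grouplike[OF that one_dim_line_comodule])
    then have "(SOME M. M \<in> iso_class H (line_comodule u)) \<in> iso_class H (line_comodule u)"
      by (rule someI)
    then show ?thesis by (simp add: iso_class_one_dim[OF one_dim_line_comodule])
  qed
  show ?thesis
    unfolding groth_basis_mult_def
    by (rule groth_class_one_dim[OF assms(3) one_dim_tensor[OF chosen[OF assms(1)] chosen[OF assms(2)]]])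
qed

text \<open>
  The classes of the lines spanned by \<open>h\<close> and \<open>h'\<close> multiply to the classes of the lines belonging to
  \<open>h h'\<close> and \<open>h' h\<close>, and an isomorphism class of lines remembers its grouplike element.
\<close>

lemma grouplikes_commute_if_Gr_commutative:
  assumes comm: "\<forall>x\<in>carrier (Gr H). \<forall>y\<in>carrier (Gr H). x \<otimes>\<^bsub>Gr H\<^esub> y = y \<otimes>\<^bsub>Gr H\<^esub> x"
    and gl: "grouplike H h" "grouplike H h'"
      "grouplike H (algebra_mult H h h')" "grouplike H (algebra_mult H h' h)"
  shows "algebra_mult H h h' = algebra_mult H h' h"
proof -
  let ?x = "\<lambda>u. frag_of (iso_class H (line_comodule u))"
  have carr: "?x u \<in> carrier (Gr H)" if "grouplike H u" for u
    using simple_comodule_grouplike[OF that one_dim_line_comodule]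
    by (auto simp: Gr_def simple_classes_def)
  have "?x h \<otimes>\<^bsub>Gr H\<^esub> ?x h' = ?x h' \<otimes>\<^bsub>Gr H\<^esub> ?x h"
    using comm carr gl by blast
  then have "?x (algebra_mult H h h') = ?x (algebra_mult H h' h)"
    by (simp add: Gr_def groth_basis_mult_lines gl)
  then have "iso_class H (line_comodule (algebra_mult H h h')) = iso_class H (line_comodule (algebra_mult H h' h))"
    by (simp only: frag_of_eq)
  moreover have "line_comodule (algebra_mult H h h') \<in> iso_class H (line_comodule (algebra_mult H h h'))"
    by (simp add: iso_class_one_dim[OF one_dim_line_comodule] one_dim_line_comodule
        right_comodule_grouplike[OF gl(3) one_dim_line_comodule])
  ultimately have "one_dim (algebra_mult H h' h) (line_comodule (algebra_mult H h h'))"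
    by (simp add: iso_class_one_dim[OF one_dim_line_comodule])
  then show ?thesis
    using one_dim_line_comodule one_dim_unique by blast
qed

section \<open>Matched pairs with a group of order two\<close>

locale Z2_cocycle_matched_pair = cocycle_matched_pair F G ract lact \<sigma> \<tau>
  for F :: "('f, 'm) monoid_scheme" and G :: "('g, 'n) monoid_scheme" and ract lact
    and \<sigma> :: "'g \<Rightarrow> 'f \<Rightarrow> 'f \<Rightarrow> 'k::field" and \<tau> +
  fixes g :: 'g
  assumes carrier_G: "carrier G = {\<one>\<^bsub>G\<^esub>, g}" and g_neq_one: "g \<noteq> \<one>\<^bsub>G\<^esub>"
begin

abbreviation "H \<equiv> bicrossed_product F G ract lact \<sigma> \<tau>"

definition fixed :: "'f set" where "fixed = {f \<in> carrier F. lact g f = f}"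

lemma g_carrier [simp]: "g \<in> carrier G" by (simp add: carrier_G)

lemma g_mult_g [simp]: "g \<otimes>\<^bsub>G\<^esub> g = \<one>\<^bsub>G\<^esub>"
proof -
  have "g \<otimes>\<^bsub>G\<^esub> g \<in> {\<one>\<^bsub>G\<^esub>, g}" using G.m_closed[of g g] by (simp add: carrier_G)
  moreover have "g \<otimes>\<^bsub>G\<^esub> g \<noteq> g" using G.r_cancel_one[of g g] g_neq_one by simp
  ultimately show ?thesis by blast
qed

lemma inv_g [simp]: "inv\<^bsub>G\<^esub> g = g"
  by (rule G.inv_equality) simp_all

text \<open>
  The identity of \<open>G\<close> is a fixed point of the action of \<open>F\<close>. Each \<open>f\<close> permutes the two elements of
  \<open>G\<close>, hence fixes \<open>g\<close> as well.
\<close>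

lemma ract_trivial:
  assumes a: "a \<in> carrier G" and f: "f \<in> carrier F"
  shows "ract a f = a"
proof -
  have one: "ract \<one>\<^bsub>G\<^esub> f' = \<one>\<^bsub>G\<^esub>" if "f' \<in> carrier F" for f'
    using ract_compat[of "\<one>\<^bsub>G\<^esub>" "\<one>\<^bsub>G\<^esub>" f'] that ract_closed[of "\<one>\<^bsub>G\<^esub>" f']
      G.r_cancel_one'[of "ract \<one>\<^bsub>G\<^esub> f'" "ract \<one>\<^bsub>G\<^esub> f'"]
    by (simp add: lact_one)
  have "ract g f \<noteq> \<one>\<^bsub>G\<^esub>"
  proof
    assume "ract g f = \<one>\<^bsub>G\<^esub>"
    then have "ract g (f \<otimes>\<^bsub>F\<^esub> inv\<^bsub>F\<^esub> f) = \<one>\<^bsub>G\<^esub>"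
      using f ract_mult[of g f "inv\<^bsub>F\<^esub> f"] one[of "inv\<^bsub>F\<^esub> f"] by simp
    then show False using f g_neq_one by (simp add: ract_one)
  qed
  then show ?thesis
    using ract_closed[OF g_carrier f] one[OF f] a by (auto simp: carrier_G)
qed

text \<open>Since \<open>ract\<close> is trivial, \<open>lact g\<close> is an endomorphism of \<open>F\<close>.\<close>

lemma subgroup_fixed: "subgroup fixed F"
proof -
  have hom: "lact g (f \<otimes>\<^bsub>F\<^esub> f') = lact g f \<otimes>\<^bsub>F\<^esub> lact g f'" if "f \<in> carrier F" "f' \<in> carrier F" for f f'
    using that by (simp add: lact_compat ract_trivial)
  have "lact g \<in> hom F F"
    by (auto simp: hom_def hom lact_closed)
  then interpret group_hom F F "lact g"
    by unfold_locales
  show ?thesis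
    by unfold_locales (auto simp: fixed_def)
qed

text \<open>
  The coefficient of \<open>p\<^sub>1 # s\<close> is \<open>1\<close> because the counit of a grouplike element has to be \<open>1\<close>.
\<close>

definition gl_elem :: "'f \<Rightarrow> 'k \<Rightarrow> ('g \<times> 'f \<Rightarrow>\<^sub>0 'k)"
  where "gl_elem s c = bvec (\<one>\<^bsub>G\<^esub>, s) + Poly_Mapping.single (g, s) c"

text \<open>
  As \<open>s\<close> is fixed by \<open>g\<close>, the coproducts of \<open>p\<^sub>1 # s\<close> and \<open>p\<^sub>g # s\<close> involve only basis elements over
  \<open>s\<close>. By the normalization of \<open>\<tau>\<close>, the only coefficient where \<open>\<Delta>(h) = h \<otimes> h\<close> is not automatic is
  that of \<open>p\<^sub>g # s \<otimes> p\<^sub>g # s\<close>, where it reads \<open>\<tau>(g, g; s) = c\<^sup>2\<close>.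
\<close>

lemma grouplike_gl_elem:
  assumes s: "s \<in> fixed" and c: "c * c = \<tau> g g s"
  shows "grouplike H (gl_elem s c)"
proof -
  have s': "s \<in> carrier F" "lact g s = s" using s by (auto simp: fixed_def)
  have "c \<noteq> 0" using c tau_nonzero[of g g s] s' by auto
  have keys: "Poly_Mapping.keys (gl_elem s c) = {(\<one>\<^bsub>G\<^esub>, s), (g, s)}"
    using \<open>c \<noteq> 0\<close> g_neq_one
    by (auto simp: gl_elem_def in_keys_iff lookup_add lookup_single when_def split: if_splits)
  have "lin_ext (hcomult H) (gl_elem s c) = lin_ext (\<lambda>d. lin_ext (\<lambda>a. bvec (a, d)) (gl_elem s c)) (gl_elem s c)"
    using s' g_neq_one
    by (simp add: gl_elem_def lin_ext_add bicrossed_product_def carrier_G tau_normal lact_one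
        vec.scale_right_distrib c[symmetric] vscale_single ac_simps)
  then show ?thesis
    unfolding grouplike_def keys using s' g_neq_one
    by (simp add: coord_space_def keys)
       (auto simp: bicrossed_product_def gl_elem_def lookup_add lookup_single when_def)
qed

lemma mult_gl_elem:
  assumes "s \<in> fixed" "t \<in> fixed"
  shows "algebra_mult H (gl_elem s c) (gl_elem t d) = gl_elem (s \<otimes>\<^bsub>F\<^esub> t) (c * d * \<sigma> g s t)"
proof -
  have "s \<in> carrier F" "t \<in> carrier F" using assms by (auto simp: fixed_def)
  then show ?thesis
    using g_neq_one
    by (simp add: algebra_mult_def gl_elem_def lin_ext_add bicrossed_product_def ract_trivial sigma_normal
        vscale_single ac_simps)
qed

text \<open>
  This is the compatibility of \<open>\<sigma>\<close> and \<open>\<tau>\<close> at \<open>a = b = g\<close>, where \<open>\<sigma>(g g; s, t) = 1\<close>; it says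
  that the products in \<open>mult_gl_elem\<close> are grouplike again.
\<close>

lemma tau_mult:
  assumes "s \<in> fixed" "t \<in> fixed" "c * c = \<tau> g g s" "d * d = \<tau> g g t"
  shows "(c * d * \<sigma> g s t) * (c * d * \<sigma> g s t) = \<tau> g g (s \<otimes>\<^bsub>F\<^esub> t)"
proof -
  have "\<tau> g g (s \<otimes>\<^bsub>F\<^esub> t) = \<sigma> g s t * \<sigma> g s t * (c * c) * (d * d)"
    using sigma_tau_compat[of g g s t] assms by (simp add: fixed_def ract_trivial sigma_normal)
  then show ?thesis by (simp add: mult_ac)
qed

lemma gl_elem_injectD: "gl_elem s c = gl_elem t d \<Longrightarrow> s = t"
proof (rule ccontr)
  assume eq: "gl_elem s c = gl_elem t d" and "s \<noteq> t"
  from eq have "Poly_Mapping.lookup (gl_elem s c) (\<one>\<^bsub>G\<^esub>, s) = Poly_Mapping.lookup (gl_elem t d) (\<one>\<^bsub>G\<^esub>, s)"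
    by simp
  then show False using \<open>s \<noteq> t\<close> g_neq_one
    by (simp add: gl_elem_def lookup_add lookup_single when_def)
qed

end

theorem corollary5p2:
  fixes F :: "('f, 'm) monoid_scheme" and G :: "('g, 'n) monoid_scheme" and g :: 'g
    and ract :: "'g \<Rightarrow> 'f \<Rightarrow> 'g" and lact :: "'g \<Rightarrow> 'f \<Rightarrow> 'f"
    and \<sigma> :: "'g \<Rightarrow> 'f \<Rightarrow> 'f \<Rightarrow> 'k::{alg_closed_field, field_char_0}"
    and \<tau> :: "'g \<Rightarrow> 'g \<Rightarrow> 'f \<Rightarrow> 'k"
    and H :: "('g \<times> 'f, 'k) based_bialgebra"
  assumes "cocycle_matched_pair F G ract lact \<sigma> \<tau>"
    and "carrier G = {\<one>\<^bsub>G\<^esub>, g}" and "g \<noteq> \<one>\<^bsub>G\<^esub>"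
    and "H = bicrossed_product F G ract lact \<sigma> \<tau>"
    and "\<forall>x\<in>carrier (Gr H). \<forall>y\<in>carrier (Gr H). x \<otimes>\<^bsub>Gr H\<^esub> y = y \<otimes>\<^bsub>Gr H\<^esub> x"
  shows "comm_group (F\<lparr>carrier := {f \<in> carrier F. lact g f = f}\<rparr>)"
proof -
  interpret cocycle_matched_pair F G ract lact \<sigma> \<tau> by fact
  interpret Z: Z2_cocycle_matched_pair F G ract lact \<sigma> \<tau> g
    by unfold_locales (use assms in auto)
  have root: "\<exists>c. c * c = \<tau> g g s" for s
    using nth_root_exists[of 2 "\<tau> g g s"] by (auto simp: power2_eq_square)
  have commute: "s \<otimes>\<^bsub>F\<^esub> t = t \<otimes>\<^bsub>F\<^esub> s" if s: "s \<in> Z.fixed" and t: "t \<in> Z.fixed" for s t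
  proof -
    obtain c d where c: "c * c = \<tau> g g s" and d: "d * d = \<tau> g g t"
      using root by metis
    have st: "s \<otimes>\<^bsub>F\<^esub> t \<in> Z.fixed" "t \<otimes>\<^bsub>F\<^esub> s \<in> Z.fixed"
      using Z.subgroup_fixed s t by (auto intro: subgroup.m_closed)
    have "algebra_mult Z.H (Z.gl_elem s c) (Z.gl_elem t d) =
        algebra_mult Z.H (Z.gl_elem t d) (Z.gl_elem s c)"
      by (rule grouplikes_commute_if_Gr_commutative[OF assms(5)[unfolded assms(4)]])
         (simp_all add: Z.mult_gl_elem Z.grouplike_gl_elem Z.tau_mult s t st c d)
    then show ?thesis
      using s t by (auto simp: Z.mult_gl_elem dest: Z.gl_elem_injectD)
  qed
  interpret S: group "F\<lparr>carrier := Z.fixed\<rparr>"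
    using subgroup.subgroup_is_group[OF Z.subgroup_fixed F.group_axioms] .
  have "comm_group (F\<lparr>carrier := Z.fixed\<rparr>)"
    by (rule S.group_comm_groupI) (simp add: commute)
  then show ?thesis by (simp add: Z.fixed_def)
qed

end
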